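(* Suppose the audit metric on $\mathcal D$ has covering number $N(\mathcal D,d_{\mathcal U},\eta)\le C_{\mathcal S}\eta^{-k}$ and a strict margin $\Omega^{\mathcal D}_{W\mid\mathcal U}(\delta/2)\ge\Omega>0$ exists. Taking $\eta\le q/8$ and $e_R\le q/16$ for $q=\min\{\delta,\Omega\}$ ensures $$\underline\Omega^{\mathcal D}_{W\mid\mathcal U}(\delta)\ge\Omega/2 .$$ Under this covering bound, the total number $B$ of individual probe outcomes obeys $$B=\widetilde O\!\left(C_{\mathcal S}\,M\,q^{-(k+2)}\right),$$ which simplifies to $\widetilde O(C_{\mathcal S}M\Omega^{-(k+2)})$ in the small-margin regime $\Omega\le\delta$.
   Context: $\mathcal S$ is a set of predictive states and $\mathcal W$ a set of tests with expected outcomes $\phi_w(s)\in[0,1]$, $w\in\mathcal W$, $s\in\mathcal S$. $\mathcal D\subseteq\mathcal S$ is a declared correction domain, $\mathcal U=\{u_1,\dots,u_M\}\subseteq\mathcal W$ is a finite audit bank, and $W\subseteq\mathcal U$ is a deployment bank. For $V\subseteq\mathcal W$, $\Phi_V(s)=(\phi_w(s))_{w\in V}$; $d_{\mathcal U}(s,s')=\lVert\Phi_{\mathcal U}(s)-\Phi_{\mathcal U}(s')\rVert_\infty$ and $d_W(s,s')=\lVert\Phi_W(s)-\Phi_W(s')\rVert_\infty$. The audited separation margin is $\Omega^{\mathcal D}_{W\mid\mathcal U}(r)=\inf\{d_W(s,s'):s,s'\in\mathcal D,\ d_{\mathcal U}(s,s')\ge r\}$ (infimum over the empty set is $+\infty$).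 $N(\mathcal D,d_{\mathcal U},\eta)$ is the covering number of $\mathcal D$ at scale $\eta$ under $d_{\mathcal U}$; $k$ is the intrinsic audit dimension and $C_{\mathcal S}$ a constant. Sampling setting: before any outcomes are observed, the protocol fixes $(\mathcal D,\mathcal U,\delta,\eta,N,M,R,\alpha)$ and anchors $s_1,\dots,s_N\in\mathcal D$ forming an $\eta$-net of $\mathcal D$ under $d_{\mathcal U}$. A conditional reset oracle initializes rollouts at the anchors: for each anchor $i$, probe $u\in\mathcal U$ and repetition $r\in\{1,\dots,R\}$, it returns an outcome $Y^{(r)}_{i,u}\in[0,1]$ with conditional mean $\phi_u(s_i)$, mutually independent across $(i,u,r)$; the total number of individual probe outcomes is $B=NMR$. Here $\alpha$ is the confidence parameter (failure probability). Empirical quantities: $\widehat\phi_u(s_i)=R^{-1}\sum_{r=1}^RY^{(r)}_{i,u}$; $e_R=\sqrt{\log(2NM/\alpha)/(2R)}$; $\widehat d_{\mathcal U}(i,j)=\max_{u\in\mathcal U}|\widehat\phi_u(s_i)-\widehat\phi_u(s_j)|$; $\widehat d_W(i,j)=\max_{u\in W}|\widehat\phi_u(s_i)-\widehat\phi_u(s_j)|$; $\widehat{\mathcal A}_\delta=\{(i,j):\widehat d_{\mathcal U}(i,j)\ge\delta-2\eta-2e_R\}$; $\widehat\Omega_{W\mid\mathcal U}(\delta)=\min_{(i,j)\in\widehat{\mathcal A}_\delta}\widehat d_W(i,j)$; and the lower certificate is $\underline\Omega^{\mathcal D}_{W\mid\mathcal U}(\delta)=\widehat\Omega_{W\mid\mathcal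 U}(\delta)-2e_R-2\eta$. $\widetilde O$ denotes an upper bound up to constants and logarithmic factors.
   Formalization: The bound on B is stated when N is the covering number and η, e_R are also at least cq for a fixed constant c>0 (without lower bounds B is unbounded); such protocols are shown to exist for q≤1. The certificate bound holds with probability at least 1-α. *)

theory Defs
  imports "HOL-Probability.Probability"
begin

text \<open>
  Sup-norm distance of two test profiles restricted to the bank \<open>V\<close>. Inserting \<open>0\<close> does not
  change the supremum of a nonempty family of absolute values; it gives the empty bank
  distance \<open>0\<close>. For finite \<open>V\<close> the supremum is a maximum.
\<close>

definition bank_dist :: "'w set \<Rightarrow> ('w \<Rightarrow> real) \<Rightarrow> ('w \<Rightarrow> real) \<Rightarrow> real" where
  "bank_dist V f g = Sup (insert 0 ((\<lambda>w. \<bar>f w - g w\<bar>) ` V))"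

definition audit_dist :: "('w \<Rightarrow> 's \<Rightarrow> real) \<Rightarrow> 'w set \<Rightarrow> 's \<Rightarrow> 's \<Rightarrow> real" where
  "audit_dist \<phi> V s s' = bank_dist V (\<lambda>w. \<phi> w s) (\<lambda>w. \<phi> w s')"

text \<open>In \<^typ>\<open>ereal\<close> the infimum of the empty set is \<open>\<infinity>\<close>.\<close>

definition separation_margin ::
    "('w \<Rightarrow> 's \<Rightarrow> real) \<Rightarrow> 's set \<Rightarrow> 'w set \<Rightarrow> 'w set \<Rightarrow> real \<Rightarrow> ereal" where
  "separation_margin \<phi> D W U r =
     (INF (s, s') \<in> {(s, s'). s \<in> D \<and> s' \<in> D \<and> r \<le> audit_dist \<phi> U s s'}.
        ereal (audit_dist \<phi> W s s'))"

definition is_net :: "('s \<Rightarrow> 's \<Rightarrow> real) \<Rightarrow> 's set \<Rightarrow> real \<Rightarrow> 's set \<Rightarrow> bool" where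
  "is_net d D \<eta> C \<longleftrightarrow> C \<subseteq> D \<and> (\<forall>x\<in>D. \<exists>c\<in>C. d x c \<le> \<eta>)"

text \<open>The centres of a cover are taken in \<open>D\<close>; the value is \<open>\<infinity>\<close> if there is no finite net.\<close>

definition covering_number :: "'s set \<Rightarrow> ('s \<Rightarrow> 's \<Rightarrow> real) \<Rightarrow> real \<Rightarrow> enat" where
  "covering_number D d \<eta> = (INF C \<in> {C. finite C \<and> is_net d D \<eta> C}. enat (card C))"

locale audit_bank =
  fixes S :: "'s set" and T :: "'w set" and \<phi> :: "'w \<Rightarrow> 's \<Rightarrow> real"
    and D :: "'s set" and U :: "'w set"
  assumes outcome_range: "\<And>w s. w \<in> T \<Longrightarrow> s \<in> S \<Longrightarrow> \<phi> w s \<in> {0..1}"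
    and domain_subset: "D \<subseteq> S" and domain_nonempty: "D \<noteq> {}"
    and bank_subset: "U \<subseteq> T" and bank_finite: "finite U" and bank_nonempty: "U \<noteq> {}"

text \<open>
  The quantities fixed before sampling. The number \<open>M\<close> of audit tests is \<^term>\<open>card U\<close>;
  the anchors are \<open>s 1, \<dots>, s N\<close>.
\<close>

locale audit_protocol = audit_bank S T \<phi> D U
  for S :: "'s set" and T :: "'w set" and \<phi> D U +
  fixes \<delta> \<eta> \<alpha> :: real and N R :: nat and s :: "nat \<Rightarrow> 's"
  assumes scale_pos: "0 < \<delta>" and net_scale_pos: "0 < \<eta>"
    and confidence: "0 < \<alpha>" "\<alpha> < 1"
    and anchors_pos: "0 < N" and repetitions_pos: "0 < R"
    and anchors_net: "is_net (audit_dist \<phi> U) D \<eta> (s ` {1..N})"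

text \<open>
  Since the anchors are fixed in advance, conditioning on the reset to \<open>s i\<close> amounts to
  prescribing the mean of the outcomes \<open>Y i u r\<close>.
\<close>

locale audit_sampling = audit_protocol S T \<phi> D U \<delta> \<eta> \<alpha> N R s + prob_space P
  for P :: "'a measure"
    and S :: "'s set" and T :: "'w set" and \<phi> D U \<delta> \<eta> \<alpha> N R s +
  fixes Y :: "nat \<Rightarrow> 'w \<Rightarrow> nat \<Rightarrow> 'a \<Rightarrow> real"
  assumes outcomes_indep:
      "indep_vars (\<lambda>_. borel) (\<lambda>(i, u, r). Y i u r) ({1..N} \<times> U \<times> {1..R})"
    and outcomes_range:
      "\<And>i u r \<omega>. i \<in> {1..N} \<Longrightarrow> u \<in> U \<Longrightarrow> r \<in> {1..R} \<Longrightarrow> \<omega> \<in> space P \<Longrightarrow> Y i u r \<omega> \<in> {0..1}"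
    and outcomes_mean:
      "\<And>i u r. i \<in> {1..N} \<Longrightarrow> u \<in> U \<Longrightarrow> r \<in> {1..R} \<Longrightarrow> expectation (Y i u r) = \<phi> u (s i)"

definition sampling_error :: "nat \<Rightarrow> nat \<Rightarrow> nat \<Rightarrow> real \<Rightarrow> real" where
  "sampling_error N M R \<alpha> = sqrt (ln (2 * real N * real M / \<alpha>) / (2 * real R))"

definition emp_mean ::
    "(nat \<Rightarrow> 'w \<Rightarrow> nat \<Rightarrow> 'a \<Rightarrow> real) \<Rightarrow> nat \<Rightarrow> 'a \<Rightarrow> nat \<Rightarrow> 'w \<Rightarrow> real" where
  "emp_mean Y R \<omega> i u = (\<Sum>r=1..R. Y i u r \<omega>) / real R"

definition emp_dist ::
    "(nat \<Rightarrow> 'w \<Rightarrow> nat \<Rightarrow> 'a \<Rightarrow> real) \<Rightarrow> nat \<Rightarrow> 'a \<Rightarrow> 'w set \<Rightarrow> nat \<Rightarrow> nat \<Rightarrow> real" where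
  "emp_dist Y R \<omega> V i j = bank_dist V (emp_mean Y R \<omega> i) (emp_mean Y R \<omega> j)"

definition emp_pairs ::
    "(nat \<Rightarrow> 'w \<Rightarrow> nat \<Rightarrow> 'a \<Rightarrow> real) \<Rightarrow> 'w set \<Rightarrow> real \<Rightarrow> real \<Rightarrow> real \<Rightarrow> nat \<Rightarrow> nat \<Rightarrow> 'a
      \<Rightarrow> (nat \<times> nat) set" where
  "emp_pairs Y U \<delta> \<eta> \<alpha> N R \<omega> =
     {(i, j). i \<in> {1..N} \<and> j \<in> {1..N} \<and>
        \<delta> - 2 * \<eta> - 2 * sampling_error N (card U) R \<alpha> \<le> emp_dist Y R \<omega> U i j}"

text \<open>The infimum is a minimum if there is an admissible pair, and \<open>\<infinity>\<close> otherwise.\<close>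

definition emp_margin ::
    "(nat \<Rightarrow> 'w \<Rightarrow> nat \<Rightarrow> 'a \<Rightarrow> real) \<Rightarrow> 'w set \<Rightarrow> 'w set \<Rightarrow> real \<Rightarrow> real \<Rightarrow> real \<Rightarrow> nat \<Rightarrow> nat
      \<Rightarrow> 'a \<Rightarrow> ereal" where
  "emp_margin Y W U \<delta> \<eta> \<alpha> N R \<omega> =
     (INF (i, j) \<in> emp_pairs Y U \<delta> \<eta> \<alpha> N R \<omega>. ereal (emp_dist Y R \<omega> W i j))"

definition lower_certificate ::
    "(nat \<Rightarrow> 'w \<Rightarrow> nat \<Rightarrow> 'a \<Rightarrow> real) \<Rightarrow> 'w set \<Rightarrow> 'w set \<Rightarrow> real \<Rightarrow> real \<Rightarrow> real \<Rightarrow> nat \<Rightarrow> nat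
      \<Rightarrow> 'a \<Rightarrow> ereal" where
  "lower_certificate Y W U \<delta> \<eta> \<alpha> N R \<omega> =
     emp_margin Y W U \<delta> \<eta> \<alpha> N R \<omega> - ereal (2 * sampling_error N (card U) R \<alpha>) - ereal (2 * \<eta>)"

text \<open>
  The event that all empirical means are accurate up to the sampling error. It does not
  depend on the deployment bank.
\<close>

definition accuracy_event ::
    "'a measure \<Rightarrow> ('w \<Rightarrow> 's \<Rightarrow> real) \<Rightarrow> 'w set \<Rightarrow> real \<Rightarrow> nat \<Rightarrow> nat \<Rightarrow> (nat \<Rightarrow> 's)
      \<Rightarrow> (nat \<Rightarrow> 'w \<Rightarrow> nat \<Rightarrow> 'a \<Rightarrow> real) \<Rightarrow> 'a set" where
  "accuracy_event P \<phi> U \<alpha> N R s Y =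
     {\<omega> \<in> space P. \<forall>i\<in>{1..N}. \<forall>u\<in>U.
        \<bar>emp_mean Y R \<omega> i u - \<phi> u (s i)\<bar> \<le> sampling_error N (card U) R \<alpha>}"

text \<open>
  Powers of this factor are what the soft-O notation hides: it collects the logarithms of all
  parameters of the complexity bound. Absolute values make every summand nonnegative.
\<close>

definition log_factor :: "real \<Rightarrow> nat \<Rightarrow> real \<Rightarrow> real \<Rightarrow> real" where
  "log_factor C M q \<alpha> = 1 + \<bar>ln C\<bar> + ln (real M) + \<bar>ln q\<bar> + ln (1 / \<alpha>)"

end

theory Submission
  imports Defs
begin

text \<open>
  The empirical distances of a pair of anchors differ from the true ones by at most \<open>2 e\<close>
  on the accuracy event, where \<open>e\<close> is the sampling error. A pair passing the
  empirical test therefore has audit distance at least \<open>\<delta> - 2 \<eta> - 4 e \<ge> \<delta> / 2\<close>, so the margin at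
  \<open>\<delta> / 2\<close> separates it by \<open>\<Omega>\<close>, and the certificate loses only \<open>4 e + 2 \<eta> \<le> \<Omega> / 2\<close>. Hoeffding's
  inequality and a union bound over the \<open>N M\<close> pairs of an anchor and a probe make the accuracy
  event likely. The budget follows by inserting \<open>N \<le> C \<eta>\<^bsup>-k\<^esup>\<close> and solving \<open>e \<ge> c q\<close> for \<open>R\<close>.
\<close>

section \<open>Distances over a finite bank, and the certificate as a finite condition\<close>

lemma bank_dist_le_iff:
  assumes "finite V"
  shows "bank_dist V f g \<le> x \<longleftrightarrow> 0 \<le> x \<and> (\<forall>w\<in>V. \<bar>f w - g w\<bar> \<le> x)"
  unfolding bank_dist_def using assms by (subst cSup_le_iff) auto

lemma bank_dist_le_add:
  assumes "finite V" "0 \<le> e"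
    and "\<And>w. w \<in> V \<Longrightarrow> \<bar>f w - f' w\<bar> \<le> e" "\<And>w. w \<in> V \<Longrightarrow> \<bar>g w - g' w\<bar> \<le> e"
  shows "bank_dist V f g \<le> bank_dist V f' g' + 2 * e"
proof -
  \<comment> \<open>The distance is an upper bound for its own family, so its characterization with
    \<open>x\<close> equal to the distance itself yields nonnegativity and all coordinate bounds at
    once.\<close>
  have "0 \<le> bank_dist V f' g' \<and> (\<forall>w\<in>V. \<bar>f' w - g' w\<bar> \<le> bank_dist V f' g')"
    using bank_dist_le_iff[OF assms(1), of f' g' "bank_dist V f' g'"] by simp
  then show ?thesis
    using assms by (fastforce simp: bank_dist_le_iff)
qed

text \<open>Each sublevel set is a finite intersection of coordinate sublevel sets, and it is empty
  for a negative level because of the inserted 0.\<close>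

lemma borel_measurable_bank_dist:
  assumes "finite V"
    and "\<And>w. w \<in> V \<Longrightarrow> (\<lambda>x. f x w) \<in> borel_measurable M"
    and "\<And>w. w \<in> V \<Longrightarrow> (\<lambda>x. g x w) \<in> borel_measurable M"
  shows "(\<lambda>x. bank_dist V (f x) (g x)) \<in> borel_measurable M"
  unfolding borel_measurable_iff_le bank_dist_le_iff[OF assms(1)]
proof
  fix a
  have "{x \<in> space M. \<bar>f x w - g x w\<bar> \<le> a} \<in> sets M" if "w \<in> V" for w
    using assms(2,3)[OF that] by measurable
  then have "{x \<in> space M. \<forall>w\<in>V. \<bar>f x w - g x w\<bar> \<le> a} \<in> sets M"
    using assms(1) by (intro sets.sets_Collect_finite_All) auto
  then show "{x \<in> space M. 0 \<le> a \<and> (\<forall>w\<in>V. \<bar>f x w - g x w\<bar> \<le> a)} \<in> sets M"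
    by (cases "0 \<le> a") auto
qed

text \<open>Extended reals are removed once and for all: an empty set of admissible pairs gives the
  value infinity on the left and a vacuous condition on the right. The right side is a finite
  combination of real inequalities, fit both for measurability and for an argument pair by
  pair.\<close>

lemma le_lower_certificate_iff:
  "ereal x \<le> lower_certificate Y W U \<delta> \<eta> \<alpha> N R \<omega> \<longleftrightarrow>
    (\<forall>i\<in>{1..N}. \<forall>j\<in>{1..N}.
      \<delta> - 2 * \<eta> - 2 * sampling_error N (card U) R \<alpha> \<le> emp_dist Y R \<omega> U i j \<longrightarrow>
      x + 2 * \<eta> + 2 * sampling_error N (card U) R \<alpha> \<le> emp_dist Y R \<omega> W i j)"
proof -
  have "ereal x \<le> lower_certificate Y W U \<delta> \<eta> \<alpha> N R \<omega> \<longleftrightarrow>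
      ereal (x + 2 * \<eta> + 2 * sampling_error N (card U) R \<alpha>) \<le> emp_margin Y W U \<delta> \<eta> \<alpha> N R \<omega>"
    unfolding lower_certificate_def
    by (cases "emp_margin Y W U \<delta> \<eta> \<alpha> N R \<omega>") (auto simp: algebra_simps)
  then show ?thesis
    unfolding emp_margin_def emp_pairs_def by (auto simp: le_INF_iff)
qed

section \<open>The sampling error of a fixed protocol\<close>

context audit_protocol
begin

lemma anchor_in_domain: "i \<in> {1..N} \<Longrightarrow> s i \<in> D"
  using anchors_net by (auto simp: is_net_def)

lemma card_bank_pos: "0 < card U"
  using bank_finite bank_nonempty by (simp add: card_gt_0_iff)

text \<open>Beyond making the square root meaningful, a lower bound away from 0 is what later lets
  the logarithm absorb the rounding of \<open>R\<close>.\<close>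

lemma log_count_ge: "ln 2 \<le> ln (2 * real N * real (card U) / \<alpha>)"
proof -
  have "1 * 1 \<le> real N * real (card U)"
    using anchors_pos card_bank_pos by (intro mult_mono) auto
  then have "2 * \<alpha> \<le> 2 * real N * real (card U)"
    using confidence by linarith
  then show ?thesis
    using confidence by (simp add: field_simps)
qed

lemma log_count_nonneg: "0 \<le> ln (2 * real N * real (card U) / \<alpha>)"
  using log_count_ge ln2_ge_two_thirds by linarith

lemma sampling_error_square:
  "(sampling_error N (card U) R \<alpha>)\<^sup>2 = ln (2 * real N * real (card U) / \<alpha>) / (2 * real R)"
  unfolding sampling_error_def using log_count_nonneg by (intro real_sqrt_pow2) auto

lemma sampling_error_nonneg: "0 \<le> sampling_error N (card U) R \<alpha>"
  unfolding sampling_error_def using log_count_nonneg by simp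

end

section \<open>Measurability, concentration and the certificate under sampling\<close>

context audit_sampling
begin

lemma outcome_measurable:
  assumes "i \<in> {1..N}" "u \<in> U" "r \<in> {1..R}"
  shows "Y i u r \<in> borel_measurable P"
proof -
  have "\<forall>(i, u, r) \<in> {1..N} \<times> U \<times> {1..R}. Y i u r \<in> borel_measurable P"
    using outcomes_indep unfolding indep_vars_def by auto
  then show ?thesis
    using assms by auto
qed

lemma emp_mean_measurable:
  assumes "i \<in> {1..N}" "u \<in> U"
  shows "(\<lambda>\<omega>. emp_mean Y R \<omega> i u) \<in> borel_measurable P"
  unfolding emp_mean_def using outcome_measurable[OF assms]
  by (intro borel_measurable_divide borel_measurable_sum borel_measurable_const) auto

lemma accuracy_event_measurable: "accuracy_event P \<phi> U \<alpha> N R s Y \<in> sets P"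
proof -
  have "{\<omega> \<in> space P. \<bar>emp_mean Y R \<omega> i u - \<phi> u (s i)\<bar> \<le> sampling_error N (card U) R \<alpha>} \<in> sets P"
    if "i \<in> {1..N}" "u \<in> U" for i u
    using emp_mean_measurable[OF that] by measurable
  then show ?thesis
    unfolding accuracy_event_def using bank_finite
    by (intro sets.sets_Collect_finite_All) auto
qed

text \<open>Bounding the probability of this event from below by that of the accuracy event uses
  monotonicity of the measure, which requires the larger set to be measurable.\<close>

lemma certificate_event_measurable:
  assumes "W \<subseteq> U"
  shows "{\<omega> \<in> space P. ereal x \<le> lower_certificate Y W U \<delta> \<eta> \<alpha> N R \<omega>} \<in> sets P"
proof -
  have *: "(\<lambda>\<omega>. emp_dist Y R \<omega> V i j) \<in> borel_measurable P"
    if "i \<in> {1..N}" "j \<in> {1..N}" "V \<subseteq> U" for i j V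
    unfolding emp_dist_def
    by (rule borel_measurable_bank_dist)
      (use that emp_mean_measurable finite_subset[OF _ bank_finite] in auto)
  have "{\<omega> \<in> space P. a \<le> emp_dist Y R \<omega> U i j \<longrightarrow> b \<le> emp_dist Y R \<omega> W i j} \<in> sets P"
    if "i \<in> {1..N}" "j \<in> {1..N}" for i j a b
    using *[OF that order_refl] *[OF that assms] by measurable
  then show ?thesis
    unfolding le_lower_certificate_iff
    by (intro sets.sets_Collect_finite_All) auto
qed

lemma prob_emp_mean_deviation_le:
  assumes i: "i \<in> {1..N}" and u: "u \<in> U" and e: "0 \<le> e"
  shows "prob {\<omega> \<in> space P. e < \<bar>emp_mean Y R \<omega> i u - \<phi> u (s i)\<bar>} \<le> 2 * exp (- 2 * real R * e\<^sup>2)"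
proof -
  \<comment> \<open>Keeping triples as indices makes this family a slice of the jointly independent
    one; \<open>sum_I\<close> translates back to sums over repetitions.\<close>
  let ?I = "{i} \<times> {u} \<times> {1..R}" and ?X = "\<lambda>(i, u, r). Y i u r"
  have inj: "inj_on (\<lambda>r. (i, u, r)) {1..R}" and I: "?I = (\<lambda>r. (i, u, r)) ` {1..R}"
    by (auto intro: inj_onI)
  have sum_I: "(\<Sum>x\<in>?I. h x) = (\<Sum>r=1..R. h (i, u, r))" for h :: "_ \<Rightarrow> real"
    unfolding I by (subst sum.reindex[OF inj]) (simp add: o_def)
  interpret H: Hoeffding_ineq P ?I ?X "\<lambda>_. 0" "\<lambda>_. 1" "real R * \<phi> u (s i)"
  proof unfold_locales
    show "indep_vars (\<lambda>_. borel) ?X ?I"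
      using outcomes_indep by (rule indep_vars_subset) (use i u in auto)
    show "AE \<omega> in P. ?X x \<omega> \<in> {0..1}" if "x \<in> ?I" for x
      using that i u outcomes_range by (intro AE_I2) auto
    have "(\<Sum>x\<in>?I. expectation (?X x)) = (\<Sum>r=1..R. \<phi> u (s i))"
      unfolding sum_I using i u outcomes_mean by (intro sum.cong) auto
    then show "real R * \<phi> u (s i) \<equiv> \<Sum>x\<in>?I. expectation (?X x)"
      by simp
  qed auto
  have R: "0 < real R"
    using repetitions_pos by simp
  have le: "prob {\<omega> \<in> space P. real R * e \<le> \<bar>(\<Sum>x\<in>?I. ?X x \<omega>) - real R * \<phi> u (s i)\<bar>}
      \<le> 2 * exp (- 2 * (real R * e)\<^sup>2 / (\<Sum>x\<in>?I. (1 - 0)\<^sup>2))"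
    by (rule H.Hoeffding_ineq_abs_ge) (use R e in \<open>auto simp: sum_I\<close>)
  \<comment> \<open>Hoeffding's bound concerns the closed event for the sum. Scaling by
    \<open>R\<close> embeds the strict event for the mean into it; strictness matches the complement
    of the accuracy event.\<close>
  have "prob {\<omega> \<in> space P. e < \<bar>emp_mean Y R \<omega> i u - \<phi> u (s i)\<bar>}
      \<le> prob {\<omega> \<in> space P. real R * e \<le> \<bar>(\<Sum>x\<in>?I. ?X x \<omega>) - real R * \<phi> u (s i)\<bar>}"
  proof (rule finite_measure_mono)
    have "(\<Sum>x\<in>?I. ?X x \<omega>) - real R * \<phi> u (s i) = real R * (emp_mean Y R \<omega> i u - \<phi> u (s i))" for \<omega>
      using R unfolding sum_I emp_mean_def by (simp add: field_simps)
    then show "{\<omega> \<in> space P. e < \<bar>emp_mean Y R \<omega> i u - \<phi> u (s i)\<bar>}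
        \<subseteq> {\<omega> \<in> space P. real R * e \<le> \<bar>(\<Sum>x\<in>?I. ?X x \<omega>) - real R * \<phi> u (s i)\<bar>}"
      using R by (auto simp: abs_mult)
    show "{\<omega> \<in> space P. real R * e \<le> \<bar>(\<Sum>x\<in>?I. ?X x \<omega>) - real R * \<phi> u (s i)\<bar>} \<in> events"
      using H.random_variable by measurable
  qed
  also note le
  also have "- 2 * (real R * e)\<^sup>2 / (\<Sum>x\<in>?I. (1 - 0)\<^sup>2) = - 2 * real R * e\<^sup>2"
    using R unfolding sum_I by (simp add: power2_eq_square)
  finally show ?thesis .
qed

lemma prob_accuracy_event: "1 - \<alpha> \<le> prob (accuracy_event P \<phi> U \<alpha> N R s Y)"
proof -
  define e where "e = sampling_error N (card U) R \<alpha>"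
  define A where
    "A = (\<lambda>(i, u). {\<omega> \<in> space P. e < \<bar>emp_mean Y R \<omega> i u - \<phi> u (s i)\<bar>})"
  have NM: "0 < real N * real (card U)" and R: "0 < real R"
    using anchors_pos card_bank_pos repetitions_pos by simp_all
  \<comment> \<open>The sampling error is the solution of this equation: the two-sided tail of a
    single mean becomes \<alpha> divided by the number of means.\<close>
  have "exp (- 2 * real R * e\<^sup>2) = exp (- ln (2 * real N * real (card U) / \<alpha>))"
    unfolding e_def sampling_error_square using R by simp
  also have "\<dots> = \<alpha> / (2 * (real N * real (card U)))"
    using NM confidence by (simp add: exp_minus mult.assoc)
  finally have tail: "2 * exp (- 2 * real R * e\<^sup>2) = \<alpha> / (real N * real (card U))"
    using NM by simp
  have A_events: "A x \<in> events" if x: "x \<in> {1..N} \<times> U" for x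
  proof -
    obtain i u where "x = (i, u)" "i \<in> {1..N}" "u \<in> U"
      using x by auto
    then show ?thesis
      unfolding A_def using emp_mean_measurable[of i u] by simp
  qed
  have "space P - accuracy_event P \<phi> U \<alpha> N R s Y = (\<Union>x\<in>{1..N} \<times> U. A x)"
    unfolding accuracy_event_def A_def e_def by (fastforce simp: not_le)
  then have "prob (space P - accuracy_event P \<phi> U \<alpha> N R s Y) = prob (\<Union>x\<in>{1..N} \<times> U. A x)"
    by simp
  also have "\<dots> \<le> (\<Sum>x\<in>{1..N} \<times> U. prob (A x))"
    using A_events bank_finite by (intro finite_measure_subadditive_finite) auto
  also have "\<dots> \<le> (\<Sum>x\<in>{1..N} \<times> U. \<alpha> / (real N * real (card U)))"
  proof (rule sum_mono)
    fix x assume "x \<in> {1..N} \<times> U"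
    then obtain i u where "x = (i, u)" "i \<in> {1..N}" "u \<in> U"
      by auto
    then show "prob (A x) \<le> \<alpha> / (real N * real (card U))"
      using prob_emp_mean_deviation_le[of i u e] tail sampling_error_nonneg
      by (simp add: A_def e_def)
  qed
  also have "\<dots> = \<alpha>"
    using anchors_pos card_bank_pos by (simp add: card_cartesian_product)
  finally show ?thesis
    using prob_compl[OF accuracy_event_measurable] by simp
qed

text \<open>Purely deterministic once \<omega> is fixed. The minimum in the two smallness hypotheses
  is used twice: its \<delta> part places an admissible pair beyond \<delta>/2, and its \<Omega>
  part pays for the loss in the certificate.\<close>

lemma le_lower_certificate:
  assumes W: "W \<subseteq> U" and margin: "ereal \<Omega> \<le> separation_margin \<phi> D W U (\<delta> / 2)"
    and \<eta>: "\<eta> \<le> min \<delta> \<Omega> / 8" and err: "sampling_error N (card U) R \<alpha> \<le> min \<delta> \<Omega> / 16"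
    and \<omega>: "\<omega> \<in> accuracy_event P \<phi> U \<alpha> N R s Y"
  shows "ereal (\<Omega> / 2) \<le> lower_certificate Y W U \<delta> \<eta> \<alpha> N R \<omega>"
  unfolding le_lower_certificate_iff
proof (intro ballI impI)
  let ?e = "sampling_error N (card U) R \<alpha>"
  fix i j
  assume i: "i \<in> {1..N}" and j: "j \<in> {1..N}"
    and pair: "\<delta> - 2 * \<eta> - 2 * ?e \<le> emp_dist Y R \<omega> U i j"
  have acc: "\<bar>emp_mean Y R \<omega> l u - \<phi> u (s l)\<bar> \<le> ?e" if "l \<in> {1..N}" "u \<in> U" for l u
    using \<omega> that by (auto simp: accuracy_event_def)
  have "emp_dist Y R \<omega> U i j \<le> audit_dist \<phi> U (s i) (s j) + 2 * ?e"
    unfolding emp_dist_def audit_dist_def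
    using acc i j bank_finite sampling_error_nonneg by (intro bank_dist_le_add) auto
  then have "\<delta> / 2 \<le> audit_dist \<phi> U (s i) (s j)"
    using pair \<eta> err by auto
  then have "separation_margin \<phi> D W U (\<delta> / 2) \<le> ereal (audit_dist \<phi> W (s i) (s j))"
    unfolding separation_margin_def using i j anchor_in_domain
    by (intro INF_lower2[of "(s i, s j)"]) auto
  then have sep: "\<Omega> \<le> audit_dist \<phi> W (s i) (s j)"
    using margin order_trans by fastforce
  have "audit_dist \<phi> W (s i) (s j) \<le> emp_dist Y R \<omega> W i j + 2 * ?e"
    unfolding emp_dist_def audit_dist_def
    using acc i j W finite_subset[OF W bank_finite] sampling_error_nonneg
    by (intro bank_dist_le_add) (auto simp: abs_minus_commute)
  then show "\<Omega> / 2 + 2 * \<eta> + 2 * ?e \<le> emp_dist Y R \<omega> W i j"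
    using sep \<eta> err by auto
qed

end

section \<open>Existence of a protocol with a minimal net\<close>

lemma covering_number_attained:
  assumes "covering_number D d \<eta> = enat n"
  obtains C where "finite C" "is_net d D \<eta> C" "card C = n"
proof -
  let ?A = "(\<lambda>C. enat (card C)) ` {C. finite C \<and> is_net d D \<eta> C}"
  have Inf: "Inf ?A = enat n"
    using assms by (simp add: covering_number_def)
  \<comment> \<open>A finite value excludes the empty family, whose infimum is infinity; a nonempty
    set in the well-order \<open>enat\<close> contains its infimum.\<close>
  have "?A \<noteq> {}"
  proof
    assume "?A = {}"
    with Inf have "Inf {} = enat n"
      by (simp only:)
    then show False
      by (simp add: top_enat_def)
  qed
  then obtain a where "a \<in> ?A"
    by blast
  then have "Inf ?A \<in> ?A"
    by (rule wellorder_InfI)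
  then show ?thesis
    using that unfolding Inf by auto
qed

text \<open>
  The admissible values of \<open>R\<close> form an interval of length at least \<open>384 L / q\<^sup>2\<close>, where
  \<open>L \<ge> ln 2\<close> is the logarithm in the sampling error; this exceeds \<open>1\<close> only because \<open>q \<le> 1\<close>.
\<close>

lemma protocol_exists:
  fixes c q :: real
  assumes bank: "audit_bank S T \<phi> D U" and c: "0 < c" "c \<le> 1 / 32" and q: "0 < q" "q \<le> 1"
    and \<delta>: "0 < \<delta>" and \<alpha>: "0 < \<alpha>" "\<alpha> < 1" and \<eta>: "0 < \<eta>"
    and fin: "ereal_of_enat (covering_number D (audit_dist \<phi> U) \<eta>) \<le> ereal B"
  shows "\<exists>N R s. audit_protocol S T \<phi> D U \<delta> \<eta> \<alpha> N R s \<and>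
             enat N = covering_number D (audit_dist \<phi> U) \<eta> \<and>
             c * q \<le> sampling_error N (card U) R \<alpha> \<and> sampling_error N (card U) R \<alpha> \<le> q / 16"
proof -
  interpret audit_bank S T \<phi> D U
    by (fact bank)
  obtain n where n: "covering_number D (audit_dist \<phi> U) \<eta> = enat n"
    using fin by (cases "covering_number D (audit_dist \<phi> U) \<eta>") auto
  then obtain A where A: "finite A" "is_net (audit_dist \<phi> U) D \<eta> A" "card A = n"
    by (rule covering_number_attained)
  obtain s where s: "bij_betw s {1..n} A"
    using ex_bij_betw_nat_finite_1[OF A(1)] A(3) by auto
  have "A \<noteq> {}"
    using A(2) domain_nonempty by (auto simp: is_net_def)
  then have n_pos: "0 < n"
    using A by auto
  define L where "L = ln (2 * real n * real (card U) / \<alpha>)"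
  \<comment> \<open>Since the squared error is \<open>L / (2 * R)\<close>, it is at most
    \<open>(q / 16)^2\<close> exactly when \<open>R\<close> is at least
    \<open>128 * L / q^2\<close>, where 128 = 16^2 / 2.\<close>
  define R where "R = nat \<lceil>128 * L / q\<^sup>2\<rceil>"
  have protocol: "audit_protocol S T \<phi> D U \<delta> \<eta> \<alpha> n r s" if "0 < r" for r
    using \<delta> \<eta> \<alpha> n_pos that A(2) bij_betw_imp_surj_on[OF s] by unfold_locales auto
  \<comment> \<open>The bound on \<open>L\<close> does not involve the repetition count, so the
    dummy value 1 gives access to it before \<open>R\<close> is known to be positive.\<close>
  interpret audit_protocol S T \<phi> D U \<delta> \<eta> \<alpha> n 1 s
    by (rule protocol) simp
  have L: "2 / 3 \<le> L"
    using log_count_ge ln2_ge_two_thirds by (simp add: L_def)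
  have q2: "0 < q\<^sup>2" "q\<^sup>2 \<le> 1"
    using q by (auto simp: power_le_one)
  have pos: "0 < 128 * L / q\<^sup>2"
    using L q2 by simp
  have lo: "128 * L / q\<^sup>2 \<le> real R"
    unfolding R_def by linarith
  then have R_pos: "0 < R"
    using pos by (metis of_nat_0_less_iff order_less_le_trans)
  have "real R \<le> 128 * L / q\<^sup>2 + 1"
    using pos unfolding R_def by linarith
  \<comment> \<open>This absorbs the rounding, as 384 * 2/3 is already at least 1. The total 512 =
    32^2 / 2 then yields an error of at least \<open>q / 32\<close>, hence the restriction on
    \<open>c\<close>.\<close>
  also have "1 \<le> 384 * L / q\<^sup>2"
    using L q2 by (simp add: pos_le_divide_eq)
  finally have hi: "real R \<le> 512 * L / q\<^sup>2"
    by simp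
  interpret R: audit_protocol S T \<phi> D U \<delta> \<eta> \<alpha> n R s
    by (rule protocol) (fact R_pos)
  let ?e = "sampling_error n (card U) R \<alpha>"
  have e2: "?e\<^sup>2 = L / (2 * real R)"
    using R.sampling_error_square by (simp add: L_def)
  have "?e\<^sup>2 \<le> (q / 16)\<^sup>2"
    unfolding e2 using lo R_pos q2 by (simp add: field_simps)
  then have upper: "?e \<le> q / 16"
    by (rule power2_le_imp_le) (use q in simp)
  have "(c * q)\<^sup>2 \<le> (1 / 32 * q)\<^sup>2"
    using c q by (intro power_mono mult_right_mono) auto
  also have "\<dots> \<le> ?e\<^sup>2"
    unfolding e2 using hi R_pos q2 by (simp add: field_simps)
  finally have "c * q \<le> ?e"
    using R.sampling_error_nonneg by (rule power2_le_imp_le)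
  with upper R.audit_protocol_axioms n show ?thesis
    by metis
qed

section \<open>The budget bound\<close>

text \<open>The part of the bound on \<open>N * R\<close> that depends on \<open>k\<close> and
  \<open>c\<close> only: \<open>c powr (- k)\<close> comes from the net, the numerator from the
  logarithm, and \<open>2 * c^2\<close> from solving the sampling error for
  \<open>R\<close>.\<close>

definition budget_constant :: "real \<Rightarrow> real \<Rightarrow> nat" where
  "budget_constant k c = nat \<lceil>c powr (- k) * ((2 + k + k * \<bar>ln c\<bar>) / (2 * c\<^sup>2))\<rceil>"

text \<open>Lower bounds on the net scale and on the sampling error become upper bounds on
  \<open>N\<close> and \<open>R\<close>. The logarithm bounding \<open>R\<close> contains
  \<open>ln N\<close>, so the bound on \<open>N\<close> enters a second time, there only through
  logarithms.\<close>

lemma (in audit_protocol) budget_le: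
  fixes k c q C :: real
  assumes k: "0 \<le> k" and c: "0 < c" and q: "0 < q" and \<eta>: "c * q \<le> \<eta>"
    and cover: "real N \<le> C * \<eta> powr (- k)"
    and err: "c * q \<le> sampling_error N (card U) R \<alpha>"
  shows "real (N * card U * R)
    \<le> real (budget_constant k c) * (C * real (card U) * q powr (- (k + 2))) * log_factor C (card U) q \<alpha>"
proof -
  define M where "M = real (card U)"
  define l where "l = log_factor C (card U) q \<alpha>"
  define L where "L = ln (2 * real N * M / \<alpha>)"
  have N: "0 < real N" and M: "1 \<le> M" and R: "0 < real R"
    using anchors_pos card_bank_pos repetitions_pos by (auto simp: M_def)
  have C: "0 < C"
    using N cover net_scale_pos by (smt (verit) mult_nonpos_nonneg powr_ge_zero)
  have cq: "0 < c * q"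
    using c q by simp
  have "\<eta> powr (- k) \<le> (c * q) powr (- k)"
    using k \<eta> cq by (intro powr_mono2') auto
  then have "real N \<le> C * (c * q) powr (- k)"
    using cover C by (meson mult_left_mono less_imp_le order_trans)
  then have N_le: "real N \<le> C * (c powr (- k) * q powr (- k))"
    using c q by (simp add: powr_mult)
  have "ln (real N) \<le> ln (C * (c powr (- k) * q powr (- k)))"
    using N N_le by simp
  also have "\<dots> = ln C - k * ln c - k * ln q"
    using C c q by (simp add: ln_mult ln_powr)
  finally have lnN: "ln (real N) \<le> ln C - k * ln c - k * ln q" .
  have nonneg: "0 \<le> ln M" "0 \<le> ln (1 / \<alpha>)"
    using M confidence by (auto simp: ln_div)
  have l: "l = 1 + \<bar>ln C\<bar> + ln M + \<bar>ln q\<bar> + ln (1 / \<alpha>)"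
    by (simp add: l_def log_factor_def M_def)
  then have l1: "1 \<le> l" and lq: "\<bar>ln q\<bar> \<le> l"
    using nonneg by auto
  have kc: "- k * ln c \<le> k * \<bar>ln c\<bar>" and kq: "- k * ln q \<le> k * \<bar>ln q\<bar>"
    using k by (simp_all add: abs_if mult_nonneg_nonneg mult_nonneg_nonpos)
  have "L = ln 2 + ln (real N) + ln M + ln (1 / \<alpha>)"
    unfolding L_def using N M confidence by (simp add: ln_mult ln_div)
  also have "\<dots> \<le> l + 1 + k * \<bar>ln c\<bar> + k * \<bar>ln q\<bar>"
    using lnN kc kq ln_2_less_1 by (simp add: l)
  \<comment> \<open>The summand 1 in \<open>log_factor\<close> ensures \<open>1 \<le> l\<close>, so
    terms without a logarithm can be multiplied by \<open>l\<close>. This leaves a bound linear in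
    \<open>l\<close>.\<close>
  also have "\<dots> \<le> l + l + k * \<bar>ln c\<bar> * l + k * l"
    using l1 lq k mult_left_mono[of 1 l "k * \<bar>ln c\<bar>"] by (intro add_mono mult_left_mono) auto
  also have "\<dots> = (2 + k + k * \<bar>ln c\<bar>) * l"
    by (simp add: algebra_simps)
  finally have L_le: "L \<le> (2 + k + k * \<bar>ln c\<bar>) * l" .
  have "(c * q)\<^sup>2 \<le> L / (2 * real R)"
    using err cq sampling_error_square by (metis L_def M_def less_imp_le power_mono)
  then have "real R \<le> L / (2 * c\<^sup>2 * q\<^sup>2)"
    using R c q by (simp add: field_simps power_mult_distrib)
  also have "\<dots> \<le> (2 + k + k * \<bar>ln c\<bar>) * l / (2 * c\<^sup>2 * q\<^sup>2)"
    using L_le by (intro divide_right_mono) auto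
  finally have R_le: "real R \<le> (2 + k + k * \<bar>ln c\<bar>) * l / (2 * c\<^sup>2 * q\<^sup>2)" .
  have "real N * real R
      \<le> (C * (c powr (- k) * q powr (- k))) * ((2 + k + k * \<bar>ln c\<bar>) * l / (2 * c\<^sup>2 * q\<^sup>2))"
    using N_le R_le N R by (intro mult_mono) auto
  also have "\<dots> = c powr (- k) * ((2 + k + k * \<bar>ln c\<bar>) / (2 * c\<^sup>2)) * (C * q powr (- (k + 2)) * l)"
  proof -
    \<comment> \<open>The exponent splits into \<open>k\<close> from the size of the net and 2 from
      the number of repetitions.\<close>
    have "q powr (- (k + 2)) = q powr (- k) / q\<^sup>2"
      using q by (simp add: powr_diff)
    then show ?thesis
      by simp
  qed
  also have "\<dots> \<le> real (budget_constant k c) * (C * q powr (- (k + 2)) * l)"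
    using C l1 real_nat_ceiling_ge unfolding budget_constant_def by (intro mult_right_mono) simp_all
  finally have "real N * real R * M \<le> real (budget_constant k c) * (C * q powr (- (k + 2)) * l) * M"
    using M by (intro mult_right_mono) auto
  then show ?thesis
    by (simp add: M_def l_def mult_ac)
qed

theorem theorem10:
  fixes k c :: real
  assumes "0 \<le> k" and "0 < c" and "c \<le> 1 / 32"
  shows
    "(\<forall>(P :: 'a measure) (S :: 's set) (T :: 'w set) \<phi> D U W \<delta> \<eta> \<alpha> N R s Y C \<Omega>.
        audit_sampling P S T \<phi> D U \<delta> \<eta> \<alpha> N R s Y \<and> W \<subseteq> U \<and>
        ereal_of_enat (covering_number D (audit_dist \<phi> U) \<eta>) \<le> ereal (C * \<eta> powr (- k)) \<and>
        0 < \<Omega> \<and> ereal \<Omega> \<le> separation_margin \<phi> D W U (\<delta> / 2) \<and>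
        \<eta> \<le> min \<delta> \<Omega> / 8 \<and> sampling_error N (card U) R \<alpha> \<le> min \<delta> \<Omega> / 16
        \<longrightarrow>
        1 - \<alpha> \<le> measure P (accuracy_event P \<phi> U \<alpha> N R s Y) \<and>
        (\<forall>\<omega> \<in> accuracy_event P \<phi> U \<alpha> N R s Y.
            ereal (\<Omega> / 2) \<le> lower_certificate Y W U \<delta> \<eta> \<alpha> N R \<omega>) \<and>
        1 - \<alpha> \<le> measure P {\<omega> \<in> space P.
            ereal (\<Omega> / 2) \<le> lower_certificate Y W U \<delta> \<eta> \<alpha> N R \<omega>})
     \<and>
     (\<exists>K p :: nat. \<forall>(S :: 's set) (T :: 'w set) \<phi> D U W \<delta> \<eta> \<alpha> C \<Omega> q.
        audit_bank S T \<phi> D U \<and> W \<subseteq> U \<and> 0 < \<delta> \<and> 0 < \<alpha> \<and> \<alpha> < 1 \<and>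
        0 < \<Omega> \<and> ereal \<Omega> \<le> separation_margin \<phi> D W U (\<delta> / 2) \<and>
        q = min \<delta> \<Omega> \<and> c * q \<le> \<eta> \<and> \<eta> \<le> q / 8 \<and>
        ereal_of_enat (covering_number D (audit_dist \<phi> U) \<eta>) \<le> ereal (C * \<eta> powr (- k))
        \<longrightarrow>
        (q \<le> 1 \<longrightarrow>
          (\<exists>N R s. audit_protocol S T \<phi> D U \<delta> \<eta> \<alpha> N R s \<and>
             enat N = covering_number D (audit_dist \<phi> U) \<eta> \<and>
             c * q \<le> sampling_error N (card U) R \<alpha> \<and> sampling_error N (card U) R \<alpha> \<le> q / 16)) \<and>
        (\<forall>N R s. audit_protocol S T \<phi> D U \<delta> \<eta> \<alpha> N R s \<and>
             enat N = covering_number D (audit_dist \<phi> U) \<eta> \<and>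
             c * q \<le> sampling_error N (card U) R \<alpha> \<and> sampling_error N (card U) R \<alpha> \<le> q / 16
             \<longrightarrow>
             real (N * card U * R)
               \<le> real K * (C * real (card U) * q powr (- (k + 2))) * log_factor C (card U) q \<alpha> ^ p \<and>
             (\<Omega> \<le> \<delta> \<longrightarrow> real (N * card U * R)
               \<le> real K * (C * real (card U) * \<Omega> powr (- (k + 2))) * log_factor C (card U) \<Omega> \<alpha> ^ p)))"
\<comment> \<open>As the logarithm is bounded linearly in the log factor, the exponent
  \<open>p = 1\<close> suffices.\<close>
proof (rule conjI[OF _ exI[of _ "budget_constant k c", OF exI[of _ 1]]];
    intro conjI allI impI; elim conjE)
  fix P :: "'a measure" and S :: "'s set" and T :: "'w set" and \<phi> D U W \<delta> \<eta> \<alpha> N R s Y C \<Omega>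
  assume "audit_sampling P S T \<phi> D U \<delta> \<eta> \<alpha> N R s Y"
    and W: "W \<subseteq> U" and margin: "ereal \<Omega> \<le> separation_margin \<phi> D W U (\<delta> / 2)"
    and \<eta>: "\<eta> \<le> min \<delta> \<Omega> / 8" and err: "sampling_error N (card U) R \<alpha> \<le> min \<delta> \<Omega> / 16"
  then interpret audit_sampling P S T \<phi> D U \<delta> \<eta> \<alpha> N R s Y
    by simp
  show prob: "1 - \<alpha> \<le> prob (accuracy_event P \<phi> U \<alpha> N R s Y)"
    by (rule prob_accuracy_event)
  show cert: "\<forall>\<omega> \<in> accuracy_event P \<phi> U \<alpha> N R s Y.
      ereal (\<Omega> / 2) \<le> lower_certificate Y W U \<delta> \<eta> \<alpha> N R \<omega>"
    using le_lower_certificate[OF W margin \<eta> err] by blast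
  have "prob (accuracy_event P \<phi> U \<alpha> N R s Y)
      \<le> prob {\<omega> \<in> space P. ereal (\<Omega> / 2) \<le> lower_certificate Y W U \<delta> \<eta> \<alpha> N R \<omega>}"
    using cert certificate_event_measurable[OF W]
    by (intro finite_measure_mono) (auto simp: accuracy_event_def)
  with prob show "1 - \<alpha> \<le> prob {\<omega> \<in> space P.
      ereal (\<Omega> / 2) \<le> lower_certificate Y W U \<delta> \<eta> \<alpha> N R \<omega>}"
    by linarith
next
  fix S :: "'s set" and T :: "'w set" and \<phi> D U and \<delta> \<eta> \<alpha> C \<Omega> q :: real
  assume "audit_bank S T \<phi> D U" "0 < \<delta>" "0 < \<alpha>" "\<alpha> < 1" "0 < \<Omega>" "q = min \<delta> \<Omega>" "c * q \<le> \<eta>"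
    "ereal_of_enat (covering_number D (audit_dist \<phi> U) \<eta>) \<le> ereal (C * \<eta> powr (- k))" "q \<le> 1"
  moreover from this have "0 < q"
    by simp
  moreover from this have "0 < c * q"
    using assms by simp
  moreover from this \<open>c * q \<le> \<eta>\<close> have "0 < \<eta>"
    by linarith
  ultimately show "\<exists>N R s. audit_protocol S T \<phi> D U \<delta> \<eta> \<alpha> N R s \<and>
      enat N = covering_number D (audit_dist \<phi> U) \<eta> \<and>
      c * q \<le> sampling_error N (card U) R \<alpha> \<and> sampling_error N (card U) R \<alpha> \<le> q / 16"
    using assms by (intro protocol_exists)
next
  fix S :: "'s set" and T :: "'w set" and \<phi> D U and \<delta> \<eta> \<alpha> C \<Omega> q :: real and N R s
  assume "audit_protocol S T \<phi> D U \<delta> \<eta> \<alpha> N R s" and N: "enat N = covering_number D (audit_dist \<phi> U) \<eta>"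
    and "0 < \<delta>" "0 < \<Omega>" and q: "q = min \<delta> \<Omega>" and \<eta>: "c * q \<le> \<eta>"
    and cover: "ereal_of_enat (covering_number D (audit_dist \<phi> U) \<eta>) \<le> ereal (C * \<eta> powr (- k))"
    and err: "c * q \<le> sampling_error N (card U) R \<alpha>"
  then interpret audit_protocol S T \<phi> D U \<delta> \<eta> \<alpha> N R s
    by simp
  have "0 < q" "real N \<le> C * \<eta> powr (- k)"
    using \<open>0 < \<delta>\<close> \<open>0 < \<Omega>\<close> q cover by (auto simp flip: N)
  then show budget: "real (N * card U * R) \<le> real (budget_constant k c) *
      (C * real (card U) * q powr (- (k + 2))) * log_factor C (card U) q \<alpha> ^ 1"
    using budget_le assms \<eta> err by simp
  \<comment> \<open>In the small-margin regime the minimum equals \<Omega>, so the bound already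
    proved is the required one.\<close>
  assume "\<Omega> \<le> \<delta>"
  then have "q = \<Omega>"
    using q by simp
  with budget show "real (N * card U * R) \<le> real (budget_constant k c) *
      (C * real (card U) * \<Omega> powr (- (k + 2))) * log_factor C (card U) \<Omega> \<alpha> ^ 1"
    by simp
qed

end
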